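(* Let $G$ be a graph of order $n\ge 2$ that has a subgraph isomorphic to the path $P_n$ on $n$ vertices. Then $$\gamma_t(M(G)) = \left\lceil \frac{2n}{3}\right\rceil.$$
   Context: All graphs are finite and simple. For a graph $H$ with no isolated vertices, a total dominating set of $H$ is a set $S\subseteq V(H)$ such that every vertex of $H$ has at least one neighbor in $S$; $\gamma_t(H)$ is the minimum cardinality of a total dominating set of $H$. The middle graph $M(G)$ of a graph $G$ has vertex set $V(G)\cup E(G)$ (disjoint union), and two of its vertices $x,y$ are adjacent exactly when either $x,y\in E(G)$ are edges of $G$ sharing a common endpoint, or $x\in V(G)$, $y\in E(G)$ and $x$ is an endpoint of $y$ (no two elements of $V(G)$ are adjacent in $M(G)$). *)

theory Defs
  imports Complex_Main
begin

record 'a graph =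
  verts :: "'a set"
  edges :: "'a set set"

definition simple_graph :: "'a graph \<Rightarrow> bool" where
  "simple_graph G \<longleftrightarrow>
     finite (verts G) \<and> (\<forall>e \<in> edges G. e \<subseteq> verts G \<and> card e = 2)"

definition adjacent :: "'a graph \<Rightarrow> 'a \<Rightarrow> 'a \<Rightarrow> bool" where
  "adjacent G u v \<longleftrightarrow> {u, v} \<in> edges G"

definition subgraph :: "'a graph \<Rightarrow> 'a graph \<Rightarrow> bool" where
  "subgraph H G \<longleftrightarrow> simple_graph H \<and> verts H \<subseteq> verts G \<and> edges H \<subseteq> edges G"

definition isomorphic :: "'a graph \<Rightarrow> 'b graph \<Rightarrow> bool" where
  "isomorphic G H \<longleftrightarrow>
     (\<exists>f. bij_betw f (verts G) (verts H) \<and>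
          (\<forall>u \<in> verts G. \<forall>v \<in> verts G. adjacent G u v \<longleftrightarrow> adjacent H (f u) (f v)))"

definition path_graph :: "nat \<Rightarrow> nat graph" where
  "path_graph n = \<lparr>verts = {..<n}, edges = {{i, Suc i} |i. Suc i < n}\<rparr>"

definition middle_graph :: "'a graph \<Rightarrow> ('a + 'a set) graph" where
  "middle_graph G =
     \<lparr>verts = Inl ` verts G \<union> Inr ` edges G,
      edges = {{Inr e, Inr f} |e f. e \<in> edges G \<and> f \<in> edges G \<and> e \<noteq> f \<and> e \<inter> f \<noteq> {}} \<union>
              {{Inl v, Inr e} |v e. v \<in> verts G \<and> e \<in> edges G \<and> v \<in> e}\<rparr>"

definition total_dominating_set :: "'a graph \<Rightarrow> 'a set \<Rightarrow> bool" where
  "total_dominating_set H S \<longleftrightarrow>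
     S \<subseteq> verts H \<and> (\<forall>v \<in> verts H. \<exists>u \<in> S. adjacent H v u)"

(* Meant for finite simple graphs without isolated vertices: a graph with an isolated vertex
   has no total dominating set, so the value is then unspecified. *)
definition total_domination_number :: "'a graph \<Rightarrow> nat" where
  "total_domination_number H = (LEAST k. \<exists>S. total_dominating_set H S \<and> card S = k)"

end

theory Submission
  imports Defs
begin

text \<open>
  Lower bound: let \<open>F\<close> be the set of edges of \<open>G\<close> lying in a total dominating set \<open>S\<close>.
  Every vertex of \<open>G\<close> is covered by \<open>F\<close>. Let each edge of \<open>F\<close> pay 2 to each of its ends of
  \<open>F\<close>-degree 1 and 1 to each other end; then every vertex receives at least 2. An edge pays at
  most 3, unless it is isolated in \<open>F\<close>. It then pays 4, but one of its ends must belong to \<open>S\<close>,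
  and that end can be charged the surplus. Hence \<open>2 n \<le> 3 |S|\<close>.

  Upper bound: along a Hamiltonian path \<open>p\<^sub>0, p\<^sub>1, \<dots>\<close>, split the vertices into consecutive
  triples and take the two path edges inside each triple. If vertices are left over, add the last
  path edge, and if exactly two are left over, add also the last vertex.
\<close>

lemma adjacent_middle_graph [simp]:
  "adjacent (middle_graph G) (Inl v) (Inl w) \<longleftrightarrow> False"
  "adjacent (middle_graph G) (Inl v) (Inr e) \<longleftrightarrow> v \<in> verts G \<and> e \<in> edges G \<and> v \<in> e"
  "adjacent (middle_graph G) (Inr e) (Inl v) \<longleftrightarrow> v \<in> verts G \<and> e \<in> edges G \<and> v \<in> e"
  "adjacent (middle_graph G) (Inr e) (Inr f) \<longleftrightarrow>
     e \<in> edges G \<and> f \<in> edges G \<and> e \<noteq> f \<and> e \<inter> f \<noteq> {}"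
  by (auto simp: adjacent_def middle_graph_def doubleton_eq_iff)

lemma verts_middle_graph [simp]: "verts (middle_graph G) = Inl ` verts G \<union> Inr ` edges G"
  by (simp add: middle_graph_def)

lemma simple_graph_finite_edges:
  assumes "simple_graph G"
  shows "finite (edges G)"
  by (rule finite_subset[of _ "Pow (verts G)"]) (use assms in \<open>auto simp: simple_graph_def\<close>)

lemma total_dominating_set_middle_graph_card_ge:
  assumes G: "simple_graph G" and S: "total_dominating_set (middle_graph G) S"
  shows "2 * card (verts G) \<le> 3 * card S"
proof -
  define F where "F = {e. Inr e \<in> S}"
  define U where "U = {v. Inl v \<in> S}"
  define d where "d v = card {e \<in> F. v \<in> e}" for v
  \<comment> \<open>\<open>c v\<close> is what each edge of \<open>F\<close> at \<open>v\<close>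
    pays to \<open>v\<close>, so \<open>v\<close> receives \<open>d v * c v\<close> in total.
    \<open>I\<close> collects the edges isolated in \<open>F\<close>, the only ones that pay
    4.\<close>
  define c where "c v = (if d v = 1 then 2 else 1 :: nat)" for v
  define I where "I = {e \<in> F. \<forall>v \<in> e. d v = 1}"
  have SS: "S \<subseteq> Inl ` verts G \<union> Inr ` edges G"
    and dom: "\<And>x. x \<in> Inl ` verts G \<union> Inr ` edges G \<Longrightarrow> \<exists>u \<in> S. adjacent (middle_graph G) x u"
    using S by (auto simp: total_dominating_set_def)
  have FE: "F \<subseteq> edges G" and UV: "U \<subseteq> verts G"
    using SS by (auto simp: F_def U_def)
  have fV: "finite (verts G)" and fF: "finite F" and fU: "finite U"
    using G FE UV simple_graph_finite_edges[OF G]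
    by (auto simp: simple_graph_def intro: finite_subset)
  have S_eq: "S = Inl ` U \<union> Inr ` F"
  proof (intro set_eqI)
    fix x show "x \<in> S \<longleftrightarrow> x \<in> Inl ` U \<union> Inr ` F"
      by (cases x) (auto simp: U_def F_def)
  qed
  have cardS: "card S = card U + card F"
    unfolding S_eq using fU fF by (subst card_Un_disjoint) (auto simp: card_image)
  have deg_unique: "e = f" if v: "d v = 1" and "e \<in> F" "f \<in> F" "v \<in> e" "v \<in> f" for e f v
  proof -
    obtain g where "{e \<in> F. v \<in> e} = {g}"
      using v unfolding d_def by (rule card_1_singletonE)
    moreover have "e \<in> {e \<in> F. v \<in> e}" "f \<in> {e \<in> F. v \<in> e}"
      using that by simp_all
    ultimately show ?thesis by simp
  qed
  \<comment> \<open>In the middle graph \<open>Inl v\<close> has only edges as neighbors, so its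
    dominator lies in \<open>F\<close> and \<open>d v\<close> is positive. The doubled rate makes up
    for degree 1.\<close>
  have "2 \<le> d v * c v" if v: "v \<in> verts G" for v
  proof -
    obtain u where "u \<in> S" "adjacent (middle_graph G) (Inl v) u"
      using dom[of "Inl v"] v by auto
    then have "{e \<in> F. v \<in> e} \<noteq> {}"
      by (cases u) (auto simp: F_def)
    then have "d v \<noteq> 0" using fF by (auto simp: d_def)
    then show ?thesis by (auto simp: c_def)
  qed
  then have "(\<Sum>v \<in> verts G. 2) \<le> (\<Sum>v \<in> verts G. d v * c v)"
    by (intro sum_mono) auto
  also have "\<dots> = (\<Sum>v \<in> verts G. \<Sum>e | e \<in> F \<and> v \<in> e. c v)"
    by (simp add: d_def)
  \<comment> \<open>Double counting: from what vertices receive to what edges pay.\<close>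
  also have "\<dots> = (\<Sum>e \<in> F. \<Sum>v | v \<in> verts G \<and> v \<in> e. c v)"
    by (rule sum.swap_restrict[OF fV fF])
  also have "\<dots> \<le> (\<Sum>e \<in> F. 3 + (if e \<in> I then 1 else 0))"
  proof (rule sum_mono)
    fix e assume e: "e \<in> F"
    then have eV: "e \<subseteq> verts G" and "card e = 2"
      using G FE by (auto simp: simple_graph_def)
    then obtain a b where ab: "e = {a, b}" "a \<noteq> b"
      by (meson card_2_iff)
    have "{v. v \<in> verts G \<and> v \<in> e} = {a, b}" using eV ab by auto
    then have "(\<Sum>v | v \<in> verts G \<and> v \<in> e. c v) = c a + c b" using ab by simp
    then show "(\<Sum>v | v \<in> verts G \<and> v \<in> e. c v) \<le> 3 + (if e \<in> I then 1 else 0)"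
      using e ab by (auto simp: c_def I_def)
  qed
  also have "\<dots> = 3 * card F + card I"
    using fF by (simp add: sum.distrib sum.If_cases I_def Int_def conj_commute cong: conj_cong)
  finally have bound: "2 * card (verts G) \<le> 3 * card F + card I" by simp
  \<comment> \<open>The edge \<open>e\<close> itself needs a dominator. Another edge of
    \<open>F\<close> meeting \<open>e\<close> would give a common end degree at least 2, so only an
    end of \<open>e\<close> remains.\<close>
  have "\<exists>v. v \<in> e \<and> v \<in> U" if e: "e \<in> I" for e
  proof -
    obtain u where u: "u \<in> S" "adjacent (middle_graph G) (Inr e) u"
      using dom[of "Inr e"] e FE by (auto simp: I_def)
    show ?thesis
    proof (cases u)
      case (Inl v)
      then show ?thesis using u by (auto simp: U_def)
    next
      case (Inr f)
      then show ?thesis using u e deg_unique[of _ e f] by (auto simp: I_def F_def)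
    qed
  qed
  then obtain h where h: "\<And>e. e \<in> I \<Longrightarrow> h e \<in> e \<and> h e \<in> U" by metis
  \<comment> \<open>The charged end has degree 1 in \<open>F\<close>, so it determines its edge and
    is charged only once.\<close>
  have "inj_on h I"
  proof (rule inj_onI)
    fix e f assume "e \<in> I" "f \<in> I" "h e = h f"
    then show "e = f" using h[of e] h[of f] deg_unique[of "h e" e f] by (auto simp: I_def)
  qed
  then have "card I \<le> card U"
    using h fU by (intro card_inj_on_le[of h]) auto
  with bound cardS show ?thesis by linarith
qed

text \<open>Edges outside \<open>S\<close> come for free: an end of such an edge is covered by some
  edge of \<open>S\<close>, which is different from it and hence adjacent to it.\<close>

lemma total_dominating_set_middle_graphI:
  assumes G: "simple_graph G" and S: "S \<subseteq> verts (middle_graph G)"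
    and cover: "\<And>v. v \<in> verts G \<Longrightarrow> \<exists>e. Inr e \<in> S \<and> v \<in> e"
    and nbr: "\<And>e. Inr e \<in> S \<Longrightarrow> \<exists>u \<in> S. adjacent (middle_graph G) (Inr e) u"
  shows "total_dominating_set (middle_graph G) S"
proof -
  have "\<exists>u \<in> S. adjacent (middle_graph G) x u" if "x \<in> verts (middle_graph G)" for x
  proof (cases x)
    case (Inl v)
    then have "v \<in> verts G" using that by auto
    with cover obtain e where "Inr e \<in> S" "v \<in> e" by blast
    with S \<open>v \<in> verts G\<close> Inl show ?thesis by (intro bexI[of _ "Inr e"]) auto
  next
    case (Inr e)
    then have e: "e \<in> edges G" using that by auto
    then have "e \<subseteq> verts G" "card e = 2" using G by (auto simp: simple_graph_def)
    then obtain v where v: "v \<in> e" "v \<in> verts G" by (auto simp: card_2_iff)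
    with cover obtain f where f: "Inr f \<in> S" "v \<in> f" by blast
    show ?thesis
    proof (cases "f = e")
      case True
      then show ?thesis using nbr f Inr by blast
    next
      case False
      then show ?thesis using S f v e Inr by (intro bexI[of _ "Inr f"]) auto
    qed
  qed
  with S show ?thesis by (simp add: total_dominating_set_def)
qed

text \<open>The bound is a division-free form of
  \<open>card S \<le> \<lceil>2 * n / 3\<rceil>\<close>.\<close>

lemma hamiltonian_path_total_dominating_set:
  assumes G: "simple_graph G" and n: "n \<ge> 2"
    and p: "bij_betw p {..<n} (verts G)"
    and pE: "\<And>i. Suc i < n \<Longrightarrow> {p i, p (Suc i)} \<in> edges G"
  shows "\<exists>S. total_dominating_set (middle_graph G) S \<and> 3 * card S \<le> 2 * n + 2"
proof -
  define k where "k = n div 3"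
  define e where "e i = {p i, p (Suc i)}" for i
  define A :: "('a + 'a set) set" where "A = (\<lambda>j. Inr (e (3 * j))) ` {..<k}"
  define B :: "('a + 'a set) set" where "B = (\<lambda>j. Inr (e (3 * j + 1))) ` {..<k}"
  \<comment> \<open>\<open>C\<close> handles the \<open>n mod 3\<close> leftover vertices. With one
    left over, \<open>e (n - 2)\<close> meets the last triple and so has a neighbor in
    \<open>B\<close>. With two, it meets no triple, and its end \<open>p (n - 1)\<close> is added to
    dominate it.\<close>
  define C :: "('a + 'a set) set"
    where "C = (if n mod 3 = 0 then {} else if n mod 3 = 1 then {Inr (e (n - 2))}
      else {Inr (e (n - 2)), Inl (p (n - 1))})"
  define S where "S = A \<union> B \<union> C"
  have nk: "n = 3 * k + n mod 3" by (simp add: k_def)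
  have pV: "p i \<in> verts G" if "i < n" for i
    using p that by (auto simp: bij_betw_def)
  have inj: "p i = p j \<longleftrightarrow> i = j" if "i < n" "j < n" for i j
    using p that by (auto simp: bij_betw_def inj_on_def)
  have eE: "e i \<in> edges G" if "Suc i < n" for i
    using pE that by (simp add: e_def)
  have adj: "adjacent (middle_graph G) (Inr (e i)) (Inr (e (Suc i)))"
    "adjacent (middle_graph G) (Inr (e (Suc i))) (Inr (e i))" if "Suc (Suc i) < n" for i
    using eE[of i] eE[of "Suc i"] that by (auto simp: e_def doubleton_eq_iff inj)
  have A: "Inr (e (3 * j)) \<in> S" and B: "Inr (e (Suc (3 * j))) \<in> S" if "j < k" for j
    using that by (auto simp: S_def A_def B_def)
  have C1: "Inr (e (n - 2)) \<in> S" if "n mod 3 \<noteq> 0"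
    using that by (auto simp: S_def C_def)
  have C2: "Inl (p (n - 1)) \<in> S" if "n mod 3 = 2"
    using that by (auto simp: S_def C_def)
  have "card A \<le> k" "card B \<le> k"
    using card_image_le[of "{..<k}"] by (auto simp: A_def B_def)
  moreover have "card C \<le> n mod 3"
  proof -
    have "n mod 3 < 3" by simp
    then show ?thesis by (auto simp: C_def card_insert_if)
  qed
  moreover have "card S \<le> card A + card B + card C"
    unfolding S_def by (meson card_Un_le add_le_mono1 order_trans)
  moreover have "n mod 3 < 3" by simp
  \<comment> \<open>\<open>3 * (2 * k + n mod 3) = 2 * n + n mod 3\<close>, and the remainder is at
    most 2.\<close>
  ultimately have "3 * card S \<le> 2 * n + 2" using nk by linarith
  moreover have "total_dominating_set (middle_graph G) S"
  proof (rule total_dominating_set_middle_graphI[OF G])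
    show "S \<subseteq> verts (middle_graph G)"
    proof -
      have "e (3 * j) \<in> edges G" "e (3 * j + 1) \<in> edges G" if "j < k" for j
        using that nk by (auto intro!: eE)
      moreover have "e (n - 2) \<in> edges G" "p (n - 1) \<in> verts G"
        using n by (auto intro!: eE pV)
      ultimately show ?thesis by (auto simp: S_def A_def B_def C_def)
    qed
  next
    fix v assume "v \<in> verts G"
    then obtain i where i: "i < n" "v = p i" using p by (auto simp: bij_betw_def)
    show "\<exists>f. Inr f \<in> S \<and> v \<in> f"
    proof (cases "i < 3 * k")
      case True
      define j where "j = i div 3"
      have j: "j < k" using True by (auto simp: j_def)
      have "i = 3 * j \<or> i = Suc (3 * j) \<or> i = Suc (Suc (3 * j))"
        unfolding j_def by presburger
      then show ?thesis using A[OF j] B[OF j] i by (auto simp: e_def)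
    next
      case False
      moreover have "n mod 3 < 3" by simp
      ultimately have r: "n mod 3 \<noteq> 0" and "i = n - 2 \<or> i = Suc (n - 2)"
        using i nk n by linarith+
      then show ?thesis using C1[OF r] i by (auto simp: e_def)
    qed
  next
    fix f assume "Inr f \<in> S"
    then consider j where "j < k" "f = e (3 * j)" | j where "j < k" "f = e (Suc (3 * j))"
      | "n mod 3 \<noteq> 0" "f = e (n - 2)"
      by (auto simp: S_def A_def B_def C_def split: if_splits)
    then show "\<exists>u \<in> S. adjacent (middle_graph G) (Inr f) u"
    proof cases
      case 1
      then show ?thesis using adj(1)[of "3 * j"] B nk by fastforce
    next
      case 2
      then show ?thesis using adj(2)[of "3 * j"] A nk by fastforce
    next
      case 3
      have "n mod 3 < 3" by simp
      with 3 consider "n mod 3 = 1" | "n mod 3 = 2" by linarith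
      then show ?thesis
      proof cases
        case r: 1
        \<comment> \<open>The last triple exists: \<open>n \<ge> 2\<close> and remainder 1 force
          \<open>k \<ge> 1\<close>.\<close>
        define j where "j = k - 1"
        have j: "j < k" "n - 2 = Suc (Suc (3 * j))" using nk n r by (simp_all add: j_def)
        have "adjacent (middle_graph G) (Inr f) (Inr (e (Suc (3 * j))))"
          unfolding 3(2) j(2) by (intro adj(2)) (use j n in linarith)
        with B[OF j(1)] show ?thesis by blast
      next
        case r: 2
        have "Suc (n - 2) = n - 1" using n by linarith
        then have "p (n - 1) \<in> e (n - 2)" by (simp add: e_def)
        then show ?thesis using 3 C2[OF r] eE[of "n - 2"] pV[of "n - 1"] n
          by (intro bexI[of _ "Inl (p (n - 1))"]) auto
      qed
    qed
  qed
  ultimately show ?thesis by blast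
qed

lemma spanning_path_enumeration:
  assumes "simple_graph G" "card (verts G) = n" "subgraph H G" "isomorphic H (path_graph n)"
  obtains p where "bij_betw p {..<n} (verts G)"
    and "\<And>i. Suc i < n \<Longrightarrow> {p i, p (Suc i)} \<in> edges G"
proof -
  obtain f where f: "bij_betw f (verts H) {..<n}"
    and iso: "\<And>u v. u \<in> verts H \<Longrightarrow> v \<in> verts H \<Longrightarrow>
      adjacent H u v \<longleftrightarrow> adjacent (path_graph n) (f u) (f v)"
    using assms(4) by (auto simp: isomorphic_def path_graph_def)
  \<comment> \<open>\<open>H\<close> spans \<open>G\<close>: its vertex set is contained in a finite
    set of the same size \<open>n\<close>.\<close>
  have VH: "verts H = verts G"
    using assms(1-3) bij_betw_same_card[OF f]
    by (intro card_subset_eq) (auto simp: simple_graph_def subgraph_def)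
  define p where "p = inv_into (verts H) f"
  have p: "bij_betw p {..<n} (verts H)"
    unfolding p_def by (rule bij_betw_inv_into[OF f])
  have "{p i, p (Suc i)} \<in> edges G" if i: "Suc i < n" for i
  proof -
    have "f (p i) = i" "f (p (Suc i)) = Suc i"
      using i f by (auto simp: p_def intro!: bij_betw_inv_into_right)
    moreover have "p i \<in> verts H" "p (Suc i) \<in> verts H"
      using i p by (auto simp: bij_betw_def)
    moreover have "adjacent (path_graph n) i (Suc i)"
      using i by (auto simp: adjacent_def path_graph_def)
    ultimately have "adjacent H (p i) (p (Suc i))" using iso by metis
    then show ?thesis using assms(3) by (auto simp: adjacent_def subgraph_def)
  qed
  with p VH that show ?thesis by metis
qed

theorem theorem2p11:
  fixes G :: "'a graph" and n :: nat
  assumes "simple_graph G"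
    and "card (verts G) = n"
    and "n \<ge> 2"
    and "\<exists>H. subgraph H G \<and> isomorphic H (path_graph n)"
  shows "int (total_domination_number (middle_graph G)) = \<lceil>2 * real n / 3\<rceil>"
proof -
  let ?P = "\<lambda>k. \<exists>S. total_dominating_set (middle_graph G) S \<and> card S = k"
  let ?t = "total_domination_number (middle_graph G)"
  obtain p where "bij_betw p {..<n} (verts G)"
    and "\<And>i. Suc i < n \<Longrightarrow> {p i, p (Suc i)} \<in> edges G"
    using assms(4) spanning_path_enumeration[OF assms(1,2)] by metis
  then obtain S where S: "total_dominating_set (middle_graph G) S" "3 * card S \<le> 2 * n + 2"
    using hamiltonian_path_total_dominating_set[OF assms(1,3)] by blast
  \<comment> \<open>This witness shows that the \<open>LEAST\<close> is attained, so the lower bound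
    for arbitrary total dominating sets applies to \<open>?t\<close>.\<close>
  then have P: "?P (card S)" by blast
  have upper: "3 * ?t \<le> 2 * n + 2"
    using Least_le[of ?P, OF P] S(2) by (simp add: total_domination_number_def)
  have "?P ?t"
    unfolding total_domination_number_def by (rule LeastI[of ?P, OF P])
  then have lower: "2 * n \<le> 3 * ?t"
    using total_dominating_set_middle_graph_card_ge[OF assms(1)] assms(2) by metis
  \<comment> \<open>\<open>3 * ?t \<le> 2 * n + 2\<close> gives the strict inequality
    \<open>?t - 1 < 2 * n / 3\<close> over the reals.\<close>
  have "\<lceil>2 * real n / 3\<rceil> = int ?t"
    by (rule ceiling_unique) (use lower upper in linarith)+
  then show ?thesis by simp
qed

end
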